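(* The cyclicity degree of the hamiltonian group $H\cong Q_8\times\mathbb{Z}_2^n\times A$, where $A$ is a finite abelian group of odd order, is given by $$\operatorname{cdeg}(H)=\frac{5\cdot 2^n}{b_{n,2}}\,\operatorname{cdeg}(A),$$ where $$b_{n,2}=|L(Q_8\times\mathbb{Z}_2^n)|=2^{n+2}+1+8\sum_{\alpha=0}^{n-2}\left(2^{n-\alpha}-2^{2\alpha+1}+2^{\alpha}\right)a_{\alpha,2}+2^{n+2}a_{n-1,2}+a_{n,2}$$ and $a_{\alpha,2}=|L(\mathbb{Z}_2^{\alpha})|$ is the number of subgroups of $\mathbb{Z}_2^{\alpha}$.
   Context: For a finite group $G$, let $L(G)$ be the set of all subgroups of $G$ and $C(G)$ the set of all cyclic subgroups of $G$. The cyclicity degree of $G$ is $\operatorname{cdeg}(G)=|C(G)|/|L(G)|$. $Q_8$ is the quaternion group of order $8$, $\mathbb{Z}_2$ is the cyclic group of order $2$, and $\mathbb{Z}_2^n$ is the direct product of $n$ copies of it (the trivial group for $n=0$, so that $a_{0,2}=1$). A hamiltonian group is a nonabelian group all of whose subgroups are normal; every finite hamiltonian group has the form $Q_8\times\mathbb{Z}_2^n\times A$ with $A$ abelian of odd order.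
   Formalization: The first power in the summand of b_{n,2} is corrected from 2^{n-α} to 2^{n+α}, since the printed formula gives 233 for n=3 while Q_8×Z_2^3 has 425 subgroups; for n=0 the term with a_{-1,2} is read as 0. *)

theory Defs
  imports Complex_Main "HOL-Algebra.Product_Groups"
begin

definition subgroups_of :: "('a, 'b) monoid_scheme \<Rightarrow> 'a set set" where
  "subgroups_of G = {K. subgroup K G}"

definition cyclic_subgroups_of :: "('a, 'b) monoid_scheme \<Rightarrow> 'a set set" where
  "cyclic_subgroups_of G = {K. subgroup K G \<and> cyclic_group (G\<lparr>carrier := K\<rparr>)}"

definition cdeg :: "('a, 'b) monoid_scheme \<Rightarrow> real" where
  "cdeg G = real (card (cyclic_subgroups_of G)) / real (card (subgroups_of G))"

definition hamiltonian_group :: "('a, 'b) monoid_scheme \<Rightarrow> bool" where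
  "hamiltonian_group G \<longleftrightarrow>
     group G \<and> \<not> comm_group G \<and> (\<forall>K. subgroup K G \<longrightarrow> K \<lhd> G)"

text \<open>
  The quaternion group consists of the eight units 1, -1, i, -i, j, -j, k, -k
  of the integral quaternions, where the quadruple (a, b, c, d) stands for the
  quaternion a + b i + c j + d k and the product is the Hamilton product.
\<close>

definition Q8 :: "(int \<times> int \<times> int \<times> int) monoid" where
  "Q8 = \<lparr>carrier =
           {(1,0,0,0), (-1,0,0,0), (0,1,0,0), (0,-1,0,0),
            (0,0,1,0), (0,0,-1,0), (0,0,0,1), (0,0,0,-1)},
         monoid.mult = (\<lambda>(a1,b1,c1,d1) (a2,b2,c2,d2).
           (a1*a2 - b1*b2 - c1*c2 - d1*d2,
            a1*b2 + b1*a2 + c1*d2 - d1*c2,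
            a1*c2 - b1*d2 + c1*a2 + d1*b2,
            a1*d2 + b1*c2 - c1*b2 + d1*a2)),
         one = (1,0,0,0)\<rparr>"

definition Z2_pow :: "nat \<Rightarrow> (nat \<Rightarrow> int) monoid" where
  "Z2_pow n = product_group {..<n} (\<lambda>_. integer_mod_group 2)"

definition a2 :: "nat \<Rightarrow> nat" where
  "a2 \<alpha> = card (subgroups_of (Z2_pow \<alpha>))"

definition b2 :: "nat \<Rightarrow> nat" where
  "b2 n = card (subgroups_of (Q8 \<times>\<times> Z2_pow n))"

text \<open>
  With these definitions, the closed form of \<^term>\<open>b2 n\<close> is
  2^(n+2) + 1 + 8 S(n) + 2^(n+2) a2(n-1) + a2(n), where S(n) is the sum over
  \<alpha> from 0 to n - 2 of (2^(n+\<alpha>) - 2^(2\<alpha>+1) + 2^\<alpha>) a2(\<alpha>).  The sum is empty for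
  n < 2 (so its range is written \<^prop>\<open>\<alpha> + 2 \<le> n\<close>, without truncated
  subtraction), and for n = 0 the term with index -1 is 0.

  The source prints 2^(n-\<alpha>) for the first power in S(n).  The two versions agree
  for n at most 2, but for n = 3 the printed one gives 233, while Q8 x Z2^3 has 425
  subgroups.  In general, the subgroups of Q8 x Z2^n that contain the square of i
  correspond to the subgroups of Z2^(n+2), and the others have no element of order
  4, so they lie in the centre, which is isomorphic to Z2^(n+1).  Hence b2(n) is
  a2(n+2) + a2(n+1) - a2(n), which is 374 + 67 - 16 for n = 3.
\<close>

end

theory Submission
  imports Defs "HOL-Algebra.Multiplicative_Group" "HOL-Computational_Algebra.Primes"
begin

text \<open>
  Subgroups of a direct product of finite groups of coprime orders are products of subgroups, and
  a product of cyclic subgroups is then cyclic.  Hence both subgroup counts of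
  \<open>(Q8 \<times> Z2^n) \<times> A\<close> factor, and it remains to treat \<open>G = Q8 \<times> Z2^n\<close>.

  Every element of \<open>G\<close> has order dividing 4, so two elements generate the same subgroup iff they are
  equal or mutually inverse; taking 1, -1, i, j, k in the first coordinate gives representatives,
  whence \<open>G\<close> has \<open>5 \<cdot> 2^n\<close> cyclic subgroups.

  The subgroups of \<open>G\<close> containing \<open>z = (-1, 1)\<close> correspond to the subgroups of
  \<open>G / \<langle>z\<rangle> = Z2^(n+2)\<close>.  The other ones have no element of order 4, so they are the subgroups of
  the centre \<open>{1, -1} \<times> Z2^n\<close> that avoid \<open>z\<close>.  This gives \<open>b2 n = a2 (n+2) + a2 (n+1) - a2 n\<close>.
  The closed form follows by induction from the recurrence
  \<open>a2 (n+2) = 2 a2 (n+1) + (2^(n+1) - 1) a2 n\<close> of Goldman and Rota, which in turn rests on the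
  Pascal rule for Gaussian binomial coefficients: a subgroup of \<open>Z2 \<times> V\<close> that is not contained in
  \<open>V\<close> amounts to a subgroup of \<open>V\<close> together with one of its cosets.
\<close>

section \<open>Images of subgroups and coprime direct products\<close>

text \<open>Powers of an element of \<open>K\<close> are the same in \<open>K\<close> as in
  \<open>G\<close>, so a cyclic subgroup is one generated by a single element. Counting cyclic
  subgroups thus becomes counting elements up to equality of what they generate.\<close>

lemma (in group) cyclic_subgroups_of_eq:
  "cyclic_subgroups_of G = (\<lambda>x. generate G {x}) ` carrier G"
proof -
  have "cyclic_group (G\<lparr>carrier := K\<rparr>) \<longleftrightarrow> (\<exists>x\<in>K. K = generate G {x})" if "subgroup K G" for K
  proof -
    interpret K: group "G\<lparr>carrier := K\<rparr>"
      using that by (rule subgroup_imp_group)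
    have "x [^]\<^bsub>G\<lparr>carrier := K\<rparr>\<^esub> (n::int) = x [^] n" if "x \<in> K" for x n
      using int_pow_consistent[OF \<open>subgroup K G\<close> that] by simp
    then have "range (\<lambda>n::int. x [^]\<^bsub>G\<lparr>carrier := K\<rparr>\<^esub> n) = generate G {x}" if "x \<in> K" for x
      using that generate_pow[of x] subgroup.mem_carrier[OF \<open>subgroup K G\<close> that] by auto
    then show ?thesis
      by (auto simp: K.cyclic_group)
  qed
  moreover have "x \<in> generate G {x}" for x
    by (simp add: generate.incl)
  ultimately have "cyclic_subgroups_of G = {K. subgroup K G \<and> (\<exists>x\<in>K. K = generate G {x})}"
    unfolding cyclic_subgroups_of_def by auto
  also have "\<dots> = (\<lambda>x. generate G {x}) ` carrier G"
    using \<open>\<And>x. x \<in> generate G {x}\<close>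
    by (auto simp: generate_is_subgroup dest: subgroup.mem_carrier)
  finally show ?thesis .
qed

text \<open>Preimages invert images: a subgroup containing the kernel is a union of its cosets. As
  \<open>h\<close> is arbitrary, this serves for quotient maps, isomorphisms and the embedding of
  the centre of \<open>Q8 \<times>\<times> Z2_pow n\<close>.\<close>

lemma (in group_hom) subgroup_correspondence:
  "bij_betw (\<lambda>K. h ` K) {K. subgroup K G \<and> kernel G H h \<subseteq> K}
     {L. subgroup L H \<and> L \<subseteq> h ` carrier G}"
proof (rule bij_betw_byWitness[where f' = "\<lambda>L. {x \<in> carrier G. h x \<in> L}"])
  show "\<forall>K\<in>{K. subgroup K G \<and> kernel G H h \<subseteq> K}. {x \<in> carrier G. h x \<in> h ` K} = K"
  proof safe
    fix K x y assume K: "subgroup K G" "kernel G H h \<subseteq> K" and x: "x \<in> carrier G"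
      and y: "y \<in> K" "h x = h y"
    have yG: "y \<in> carrier G"
      using K y by (auto intro: subgroup.mem_carrier)
    have "x \<otimes> inv y \<in> kernel G H h"
      using x y yG by (simp add: kernel_def)
    then have "x \<otimes> inv y \<otimes> y \<in> K"
      using K y by (blast intro: subgroup.m_closed)
    then show "x \<in> K"
      using x yG by (simp add: G.m_assoc)
  qed (auto intro: subgroup.mem_carrier)
  show "\<forall>L\<in>{L. subgroup L H \<and> L \<subseteq> h ` carrier G}. h ` {x \<in> carrier G. h x \<in> L} = L"
    by auto
  show "(\<lambda>K. h ` K) ` {K. subgroup K G \<and> kernel G H h \<subseteq> K}
      \<subseteq> {L. subgroup L H \<and> L \<subseteq> h ` carrier G}"
    using subgroup_img_is_subgroup by (auto dest: subgroup.subset)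
  have "subgroup {x \<in> carrier G. h x \<in> L} G" if "subgroup L H" for L
    by (rule G.subgroupI)
      (use subgroup.one_closed[OF that] in \<open>auto intro: exI[of _ \<one>] subgroup.m_closed[OF that] subgroup.m_inv_closed[OF that]\<close>)
  then show "(\<lambda>L. {x \<in> carrier G. h x \<in> L}) ` {L. subgroup L H \<and> L \<subseteq> h ` carrier G}
      \<subseteq> {K. subgroup K G \<and> kernel G H h \<subseteq> K}"
    by (auto simp: kernel_def subgroup.one_closed)
qed

lemma (in group_hom) card_subgroups_containing_kernel:
  assumes "h ` carrier G = carrier H"
  shows "card {K. subgroup K G \<and> kernel G H h \<subseteq> K} = card (subgroups_of H)"
  using bij_betw_same_card[OF subgroup_correspondence] assms
  by (auto simp: subgroups_of_def intro!: arg_cong[where f = card] dest: subgroup.subset)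

lemma (in group_hom) bij_betw_subgroups_of_iso:
  assumes "bij_betw h (carrier G) (carrier H)"
  shows "bij_betw (\<lambda>K. h ` K) (subgroups_of G) (subgroups_of H)"
proof -
  have "kernel G H h \<subseteq> {\<one>}"
    using assms inj_on_one_iff by (auto simp: kernel_def bij_betw_def)
  then have "{K. subgroup K G \<and> kernel G H h \<subseteq> K} = subgroups_of G"
    by (auto simp: subgroups_of_def dest: subgroup.one_closed)
  moreover have "{L. subgroup L H \<and> L \<subseteq> h ` carrier G} = subgroups_of H"
    using assms by (auto simp: subgroups_of_def bij_betw_def dest: subgroup.subset)
  ultimately show ?thesis
    using subgroup_correspondence by simp
qed

lemma iso_card_subgroups_of:
  assumes "G \<cong> H" "group G" "group H"
  shows "card (subgroups_of G) = card (subgroups_of H)"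
proof -
  obtain h where h: "h \<in> hom G H" "bij_betw h (carrier G) (carrier H)"
    using assms(1) by (auto simp: is_iso_def iso_def)
  interpret group_hom G H h
    using assms h by (simp add: group_hom_def group_hom_axioms_def)
  show ?thesis
    using bij_betw_same_card[OF bij_betw_subgroups_of_iso[OF h(2)]] .
qed

text \<open>The image of \<open>generate G {x}\<close> is \<open>generate H {h x}\<close>, so the
  bijection between all subgroups restricts to the cyclic ones.\<close>

lemma iso_card_cyclic_subgroups_of:
  assumes "G \<cong> H" "group G" "group H"
  shows "card (cyclic_subgroups_of G) = card (cyclic_subgroups_of H)"
proof -
  obtain h where h: "h \<in> hom G H" "bij_betw h (carrier G) (carrier H)"
    using assms(1) by (auto simp: is_iso_def iso_def)
  interpret group_hom G H h
    using assms h by (simp add: group_hom_def group_hom_axioms_def)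
  have "cyclic_subgroups_of H = (\<lambda>x. generate H {x}) ` h ` carrier G"
    using h by (simp add: H.cyclic_subgroups_of_eq bij_betw_def)
  also have "\<dots> = (\<lambda>K. h ` K) ` cyclic_subgroups_of G"
    using generate_img[of "{_}"] by (simp add: G.cyclic_subgroups_of_eq image_image)
  finally have "cyclic_subgroups_of H = (\<lambda>K. h ` K) ` cyclic_subgroups_of G" .
  moreover have "inj_on (\<lambda>K. h ` K) (cyclic_subgroups_of G)"
    using bij_betw_imp_inj_on[OF bij_betw_subgroups_of_iso[OF h(2)]]
    by (rule inj_on_subset) (auto simp: cyclic_subgroups_of_def subgroups_of_def)
  ultimately show ?thesis
    by (simp add: card_image)
qed

section \<open>Direct products of groups of coprime orders\<close>

lemma group_hom_fst:
  assumes "group G" "group H"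
  shows "group_hom (G \<times>\<times> H) G fst"
  using assms hom_of_fst[of H id G G]
  by (simp add: group_hom_def group_hom_axioms_def DirProd_group hom_def)

lemma group_hom_snd:
  assumes "group G" "group H"
  shows "group_hom (G \<times>\<times> H) H snd"
  using assms hom_of_snd[of G id H H]
  by (simp add: group_hom_def group_hom_axioms_def DirProd_group hom_def)

text \<open>A power with exponent divisible by \<open>order H\<close> and congruent to 1 modulo
  \<open>order G\<close> fixes the first coordinate and kills the second. So \<open>K\<close>
  contains \<open>(x, \<one>)\<close> along with \<open>(x, y)\<close>, and coordinates of different
  elements can be recombined.\<close>

lemma subgroup_DirProd_coprime:
  assumes G: "group G" and H: "group H" and fin: "finite (carrier H)"
    and cop: "coprime (order G) (order H)" and K: "subgroup K (G \<times>\<times> H)"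
  shows "K = fst ` K \<times> snd ` K"
proof -
  interpret G: group G by fact
  interpret H: group H by fact
  interpret P: group "G \<times>\<times> H" by (rule DirProd_group[OF G H])
  have pow: "(x, y) [^]\<^bsub>G \<times>\<times> H\<^esub> (k::nat) = (x [^]\<^bsub>G\<^esub> k, y [^]\<^bsub>H\<^esub> k)" for x y k
    by (induction k) auto
  have K1: "(x, \<one>\<^bsub>H\<^esub>) \<in> K" if "(x, y) \<in> K" for x y
  proof -
    have xy: "x \<in> carrier G" "y \<in> carrier H"
      using subgroup.mem_carrier[OF K that] by auto
    \<comment> \<open>\<open>bezout_nat\<close> requires \<open>order H\<close> to be nonzero, which
      is where finiteness of \<open>H\<close> enters.\<close>
    obtain u v where uv: "order H * u = order G * v + 1"
      using bezout_nat[of "order H" "order G"] cop fin H.order_gt_0_iff_finite by (auto simp: coprime_iff_gcd_eq_1 gcd.commute)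
    have "x [^]\<^bsub>G\<^esub> (order H * u) = x"
      using xy G.pow_order_eq_1[of x] by (simp add: uv G.nat_pow_pow[symmetric])
    moreover have "y [^]\<^bsub>H\<^esub> (order H * u) = \<one>\<^bsub>H\<^esub>"
      using xy H.pow_order_eq_1[of y] by (simp add: H.nat_pow_pow[symmetric])
    moreover have "(x, y) [^]\<^bsub>G \<times>\<times> H\<^esub> (order H * u) \<in> K"
      using P.subgroup_int_pow_closed[OF K that, of "int (order H * u)"] by (simp only: int_pow_int)
    ultimately show ?thesis
      by (simp add: pow)
  qed
  have "(x, y') \<in> K" if "(x, y) \<in> K" "(x', y') \<in> K" for x y x' y'
  proof -
    have c: "x \<in> carrier G" "x' \<in> carrier G" "y' \<in> carrier H"
      using subgroup.mem_carrier[OF K] that by auto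
    \<comment> \<open>This product replaces the first coordinate of \<open>(x', y')\<close> by
      \<open>x\<close>.\<close>
    have "(x, \<one>\<^bsub>H\<^esub>) \<otimes>\<^bsub>G \<times>\<times> H\<^esub> inv\<^bsub>G \<times>\<times> H\<^esub> (x', \<one>\<^bsub>H\<^esub>) \<otimes>\<^bsub>G \<times>\<times> H\<^esub> (x', y') \<in> K"
      using K1 that K by (meson subgroup.m_closed subgroup.m_inv_closed)
    then show ?thesis
      using c by (simp add: inv_DirProd[OF G H] G.m_assoc)
  qed
  then show ?thesis
    by force
qed

lemma inj_on_Times_sets:
  assumes "{} \<notin> \<A>" "{} \<notin> \<B>"
  shows "inj_on (\<lambda>(K, L). K \<times> L) (\<A> \<times> \<B>)"
  using assms by (auto simp: inj_on_def times_eq_iff)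

lemma card_subgroups_of_DirProd_coprime:
  assumes G: "group G" and H: "group H" and fin: "finite (carrier H)"
    and cop: "coprime (order G) (order H)"
  shows "card (subgroups_of (G \<times>\<times> H)) = card (subgroups_of G) * card (subgroups_of H)"
proof -
  interpret F: group_hom "G \<times>\<times> H" G fst
    using G H by (rule group_hom_fst)
  interpret S: group_hom "G \<times>\<times> H" H snd
    using G H by (rule group_hom_snd)
  have "subgroups_of (G \<times>\<times> H) = (\<lambda>(K, L). K \<times> L) ` (subgroups_of G \<times> subgroups_of H)"
  proof (intro equalityI subsetI)
    fix K assume "K \<in> subgroups_of (G \<times>\<times> H)"
    then have K: "subgroup K (G \<times>\<times> H)"
      by (simp add: subgroups_of_def)
    then show "K \<in> (\<lambda>(K, L). K \<times> L) ` (subgroups_of G \<times> subgroups_of H)"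
      using subgroup_DirProd_coprime[OF G H fin cop K]
        F.subgroup_img_is_subgroup[OF K] S.subgroup_img_is_subgroup[OF K]
      by (auto simp: subgroups_of_def intro!: image_eqI[of _ _ "(fst ` K, snd ` K)"])
  qed (auto simp: subgroups_of_def DirProd_subgroups G H)
  moreover have "inj_on (\<lambda>(K, L). K \<times> L) (subgroups_of G \<times> subgroups_of H)"
    by (intro inj_on_Times_sets) (auto simp: subgroups_of_def subgroup_nonempty)
  ultimately show ?thesis
    by (simp add: card_image card_cartesian_product)
qed

text \<open>By coprimality, \<open>generate (G \<times>\<times> H) {(x, y)}\<close> is the product
  of its two projections, and these are generated by \<open>x\<close> and \<open>y\<close>.\<close>

lemma card_cyclic_subgroups_of_DirProd_coprime:
  assumes G: "group G" and H: "group H" and fin: "finite (carrier H)"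
    and cop: "coprime (order G) (order H)"
  shows "card (cyclic_subgroups_of (G \<times>\<times> H)) =
    card (cyclic_subgroups_of G) * card (cyclic_subgroups_of H)"
proof -
  interpret F: group_hom "G \<times>\<times> H" G fst
    using G H by (rule group_hom_fst)
  interpret S: group_hom "G \<times>\<times> H" H snd
    using G H by (rule group_hom_snd)
  have gen: "generate (G \<times>\<times> H) {(x, y)} = generate G {x} \<times> generate H {y}"
    if "x \<in> carrier G" "y \<in> carrier H" for x y
    using subgroup_DirProd_coprime[OF G H fin cop F.G.generate_is_subgroup[of "{(x, y)}"]]
      F.generate_img[of "{(x, y)}"] S.generate_img[of "{(x, y)}"] that by simp
  have "cyclic_subgroups_of (G \<times>\<times> H) =
      (\<lambda>(K, L). K \<times> L) ` (cyclic_subgroups_of G \<times> cyclic_subgroups_of H)"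
  proof -
    have "cyclic_subgroups_of (G \<times>\<times> H) =
        (\<lambda>p. generate G {fst p} \<times> generate H {snd p}) ` (carrier G \<times> carrier H)"
      unfolding F.G.cyclic_subgroups_of_eq carrier_DirProd
      by (rule image_cong) (auto simp: gen)
    also have "\<dots> = (\<lambda>(K, L). K \<times> L) ` (map_prod (\<lambda>x. generate G {x}) (\<lambda>y. generate H {y})
        ` (carrier G \<times> carrier H))"
      by (auto simp: image_image case_prod_unfold)
    finally show ?thesis
      by (simp add: map_prod_surj_on F.H.cyclic_subgroups_of_eq S.H.cyclic_subgroups_of_eq)
  qed
  moreover have "inj_on (\<lambda>(K, L). K \<times> L) (cyclic_subgroups_of G \<times> cyclic_subgroups_of H)"
    by (intro inj_on_Times_sets) (auto simp: cyclic_subgroups_of_def subgroup_nonempty)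
  ultimately show ?thesis
    by (simp add: card_image card_cartesian_product)
qed

section \<open>Subgroups of elementary abelian 2-groups\<close>

lemma finite_subgroups:
  assumes "finite (carrier G)"
  shows "finite {K. subgroup K G}"
  by (rule finite_subset[of _ "Pow (carrier G)"]) (auto simp: assms dest: subgroup.subset)

text \<open>Cut a subgroup into its slices over 0 and over 1. The first is a subgroup
  \<open>M\<close> of \<open>V\<close>; the second is empty or a coset of \<open>M\<close>, and in
  the latter case the order is \<open>2 * card M\<close>. Every coset occurs because
  \<open>V\<close> has exponent 2. Keeping track of the order \<open>c\<close> prepares the Pascal
  rule.\<close>

lemma card_subgroups_Z2_DirProd:
  fixes V :: "('a, 'b) monoid_scheme"
  assumes "comm_group V" and fin: "finite (carrier V)"
    and inv2: "\<And>x. x \<in> carrier V \<Longrightarrow> x \<otimes>\<^bsub>V\<^esub> x = \<one>\<^bsub>V\<^esub>"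
  shows "card {K. subgroup K (integer_mod_group 2 \<times>\<times> V) \<and> card K = c} =
    card {M. subgroup M V \<and> card M = c} +
    (\<Sum>M | subgroup M V \<and> 2 * card M = c. card (rcosets\<^bsub>V\<^esub> M))"
proof -
  interpret V: comm_group V by fact
  let ?P = "integer_mod_group 2 \<times>\<times> V"
  interpret P: group ?P
    by (simp add: DirProd_group)
  have inv_V: "inv\<^bsub>V\<^esub> x = x" if "x \<in> carrier V" for x
    using that inv2 by (simp add: V.inv_equality)
  have Z2: "carrier (integer_mod_group 2) = {0, 1}"
    by (auto simp: carrier_integer_mod_group)
  have inv_P: "inv\<^bsub>?P\<^esub> p = p" if "p \<in> carrier ?P" for p
    by (rule P.inv_equality) (use that inv2 Z2 in auto)
  \<comment> \<open>\<open>M\<close> and \<open>D\<close> are the slices over 0 and 1;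
    \<open>D = {}\<close> encodes a subgroup lying inside the copy of \<open>V\<close>.\<close>
  define \<Phi> where "\<Phi> = (\<lambda>(M :: 'a set, D). {0::int} \<times> M \<union> {1} \<times> D)"
  define A where "A = {M. subgroup M V \<and> card M = c}"
  define B where "B = {M. subgroup M V \<and> 2 * card M = c}"
  have finB: "finite B" "finite A"
    using finite_subgroups[OF fin] by (auto simp: A_def B_def)
  have rc: "finite (rcosets\<^bsub>V\<^esub> M)" if "M \<in> B" for M
    using that fin V.rcosets_subset_PowG[of M] by (auto simp: B_def intro: finite_subset)
  have D: "card D = card M" "D \<noteq> {}" "finite D" if "subgroup M V" "D \<in> rcosets\<^bsub>V\<^esub> M" for M D
    using that V.card_rcosets_equal[OF that(2)] subgroup.subset[OF that(1)]
      finite_subset[OF subgroup.subset[OF that(1)] fin] V.rcosets_finite[OF that(2)]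
      subgroup.one_closed[OF that(1)]
    by (auto simp: card_gt_0_iff)
  have card_\<Phi>: "card (\<Phi> (M, D)) = card M + card D" if "finite M" "finite D" for M D
    using that by (subst \<Phi>_def, subst case_prod_conv, subst card_Un_disjoint) (auto simp: card_cartesian_product)
  have sub0: "subgroup (\<Phi> (M, {})) ?P" if "subgroup M V" for M
    using DirProd_subgroups[of "integer_mod_group 2" "{0}" V M] that
      group.triv_subgroup[of "integer_mod_group 2"] by (simp add: \<Phi>_def)
  have sub1: "subgroup (\<Phi> (M, M #>\<^bsub>V\<^esub> d)) ?P" if M: "subgroup M V" and d: "d \<in> carrier V" for M d
  proof (rule P.subgroupI)
    have Mc: "x \<in> carrier V" if "x \<in> M" for x
      using M that by (rule subgroup.mem_carrier)
    show sub: "\<Phi> (M, M #>\<^bsub>V\<^esub> d) \<subseteq> carrier ?P"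
      using Mc d by (auto simp: \<Phi>_def Z2 r_coset_def)
    show "\<Phi> (M, M #>\<^bsub>V\<^esub> d) \<noteq> {}"
      using subgroup.one_closed[OF M] by (auto simp: \<Phi>_def)
    show "inv\<^bsub>?P\<^esub> p \<in> \<Phi> (M, M #>\<^bsub>V\<^esub> d)" if "p \<in> \<Phi> (M, M #>\<^bsub>V\<^esub> d)" for p
      using that inv_P sub by auto
    \<comment> \<open>Two elements over 1 multiply to an element over 0, and
      \<open>d \<otimes> d = \<one>\<close> puts it into \<open>M\<close>.\<close>
    have a: "x \<otimes>\<^bsub>V\<^esub> d \<otimes>\<^bsub>V\<^esub> (y \<otimes>\<^bsub>V\<^esub> d) = x \<otimes>\<^bsub>V\<^esub> y" if "x \<in> carrier V" "y \<in> carrier V" for x y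
    proof -
      have "x \<otimes>\<^bsub>V\<^esub> d \<otimes>\<^bsub>V\<^esub> (y \<otimes>\<^bsub>V\<^esub> d) = (x \<otimes>\<^bsub>V\<^esub> y) \<otimes>\<^bsub>V\<^esub> (d \<otimes>\<^bsub>V\<^esub> d)"
        using that d by (simp add: V.m_ac)
      then show ?thesis
        using that d inv2 by simp
    qed
    have b: "x \<otimes>\<^bsub>V\<^esub> d \<otimes>\<^bsub>V\<^esub> y = x \<otimes>\<^bsub>V\<^esub> y \<otimes>\<^bsub>V\<^esub> d" "x \<otimes>\<^bsub>V\<^esub> (y \<otimes>\<^bsub>V\<^esub> d) = x \<otimes>\<^bsub>V\<^esub> y \<otimes>\<^bsub>V\<^esub> d" if "x \<in> carrier V" "y \<in> carrier V" for x y
      using that d by (simp_all add: V.m_ac)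
    have coset: "x \<otimes>\<^bsub>V\<^esub> y \<otimes>\<^bsub>V\<^esub> d \<in> M #>\<^bsub>V\<^esub> d" if "x \<in> M" "y \<in> M" for x y
      using subgroup.m_closed[OF M that] by (auto simp: r_coset_def)
    have coset_cases: "\<exists>m\<in>M. x = m \<otimes>\<^bsub>V\<^esub> d" if "x \<in> M #>\<^bsub>V\<^esub> d" for x
      using that by (auto simp: r_coset_def)
    show "p \<otimes>\<^bsub>?P\<^esub> q \<in> \<Phi> (M, M #>\<^bsub>V\<^esub> d)"
      if "p \<in> \<Phi> (M, M #>\<^bsub>V\<^esub> d)" "q \<in> \<Phi> (M, M #>\<^bsub>V\<^esub> d)" for p q
      using that by (auto simp: \<Phi>_def a b Mc subgroup.m_closed[OF M] coset dest!: coset_cases)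
  qed
  have "{K. subgroup K ?P \<and> card K = c} = \<Phi> ` (A \<times> {{}} \<union> (SIGMA M:B. rcosets\<^bsub>V\<^esub> M))"
  proof (intro equalityI subsetI)
    fix K assume "K \<in> {K. subgroup K ?P \<and> card K = c}"
    then have K: "subgroup K ?P" and c: "card K = c" by auto
    define M where "M = {v. (0, v) \<in> K}"
    define D where "D = {v. (1, v) \<in> K}"
    have Kc: "K \<subseteq> {0, 1} \<times> carrier V"
      using subgroup.subset[OF K] Z2 by simp
    then have K_eq: "K = \<Phi> (M, D)"
      by (auto simp: \<Phi>_def M_def D_def)
    have MD: "M \<subseteq> carrier V" "D \<subseteq> carrier V"
      using Kc by (auto simp: M_def D_def)
    have "subgroup M V"
    proof (rule V.subgroupI)
      show "M \<noteq> {}"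
        using subgroup.one_closed[OF K] by (auto simp: M_def)
      show "inv\<^bsub>V\<^esub> x \<in> M" if "x \<in> M" for x
        using that MD inv_V by auto
      show "x \<otimes>\<^bsub>V\<^esub> y \<in> M" if "x \<in> M" "y \<in> M" for x y
        using subgroup.m_closed[OF K, of "(0, x)" "(0, y)"] that by (simp add: M_def)
    qed (rule MD)
    show "K \<in> \<Phi> ` (A \<times> {{}} \<union> (SIGMA M:B. rcosets\<^bsub>V\<^esub> M))"
    proof (cases "D = {}")
      case True
      then show ?thesis
        using K_eq c \<open>subgroup M V\<close> card_\<Phi>[of M "{}"] finite_subset[OF MD(1) fin] by (auto simp: A_def)
    next
      case False
      then obtain d where d: "d \<in> D" by auto
      then have dV: "d \<in> carrier V" using MD by auto
      have "D = M #>\<^bsub>V\<^esub> d"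
      proof (intro equalityI subsetI)
        fix v assume v: "v \<in> D"
        have "v \<otimes>\<^bsub>V\<^esub> d \<in> M"
          using subgroup.m_closed[OF K, of "(1, v)" "(1, d)"] v d by (simp add: D_def M_def)
        moreover have "v \<otimes>\<^bsub>V\<^esub> d \<otimes>\<^bsub>V\<^esub> d = v"
          using v MD dV inv2 by (auto simp: V.m_assoc)
        ultimately show "v \<in> M #>\<^bsub>V\<^esub> d"
          by (force simp: r_coset_def)
      next
        fix v assume "v \<in> M #>\<^bsub>V\<^esub> d"
        then obtain m where m: "m \<in> M" "v = m \<otimes>\<^bsub>V\<^esub> d"
          by (auto simp: r_coset_def)
        then show "v \<in> D"
          using subgroup.m_closed[OF K, of "(0, m)" "(1, d)"] d by (simp add: D_def M_def)
      qed
      then have "D \<in> rcosets\<^bsub>V\<^esub> M"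
        using dV by (auto simp: RCOSETS_def)
      moreover have "M \<in> B"
        using K_eq c \<open>subgroup M V\<close> card_\<Phi>[of M D] D[OF _ \<open>D \<in> rcosets\<^bsub>V\<^esub> M\<close>] finite_subset[OF MD(1) fin]
        by (simp add: B_def)
      ultimately show ?thesis
        using K_eq by auto
    qed
  next
    fix K assume "K \<in> \<Phi> ` (A \<times> {{}} \<union> (SIGMA M:B. rcosets\<^bsub>V\<^esub> M))"
    then consider M where "M \<in> A" "K = \<Phi> (M, {})"
      | M D where "M \<in> B" "D \<in> rcosets\<^bsub>V\<^esub> M" "K = \<Phi> (M, D)"
      by auto
    then show "K \<in> {K. subgroup K ?P \<and> card K = c}"
    proof cases
      case 1
      then show ?thesis
        using sub0 card_\<Phi>[of M "{}"] finite_subset[OF subgroup.subset fin] by (auto simp: A_def)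
    next
      case 2
      moreover obtain d where "d \<in> carrier V" "D = M #>\<^bsub>V\<^esub> d"
        using 2 by (auto simp: RCOSETS_def)
      ultimately show ?thesis
        using sub1 card_\<Phi>[of M D] D[of M D] finite_subset[OF subgroup.subset[of M V] fin] by (auto simp: B_def)
    qed
  qed
  moreover have "inj \<Phi>"
    by (rule inj_on_inverseI[where g = "\<lambda>K. ({v. (0, v) \<in> K}, {v. (1, v) \<in> K})"]) (auto simp: \<Phi>_def)
  ultimately have "card {K. subgroup K ?P \<and> card K = c} =
      card (A \<times> {{}} \<union> (SIGMA M:B. rcosets\<^bsub>V\<^esub> M))"
    by (simp add: card_image inj_on_subset)
  also have "\<dots> = card (A \<times> {{}::'a set}) + card (SIGMA M:B. rcosets\<^bsub>V\<^esub> M)"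
    \<comment> \<open>The two families are disjoint since cosets are nonempty.\<close>
    using D(2) finB rc by (intro card_Un_disjoint) (auto simp: B_def)
  finally show ?thesis
    using finB rc by (simp add: card_cartesian_product A_def B_def)
qed

lemma iso_card_subgroups_of_card:
  assumes "G \<cong> H" "group G" "group H"
  shows "card {K. subgroup K G \<and> card K = c} = card {K. subgroup K H \<and> card K = c}"
proof -
  obtain h where h: "h \<in> hom G H" "bij_betw h (carrier G) (carrier H)"
    using assms(1) by (auto simp: is_iso_def iso_def)
  interpret group_hom G H h
    using assms h by (simp add: group_hom_def group_hom_axioms_def)
  have bij: "bij_betw (\<lambda>K. h ` K) (subgroups_of G) (subgroups_of H)"
    by (rule bij_betw_subgroups_of_iso[OF h(2)])
  have card: "card (h ` K) = card K" if "K \<in> subgroups_of G" for K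
    using that h(2) by (auto simp: subgroups_of_def bij_betw_def intro!: card_image
        dest: subgroup.subset intro: inj_on_subset)
  have "bij_betw (\<lambda>K. h ` K) {K \<in> subgroups_of G. card K = c} {K \<in> subgroups_of H. card K = c}"
    using bij card by (auto intro!: bij_betw_Collect)
  then show ?thesis
    by (simp add: bij_betw_same_card subgroups_of_def)
qed

section \<open>The groups \<open>Z2_pow n\<close> and their subgroups of given order\<close>

lemma group_Z2_pow [simp]: "group (Z2_pow n)"
  by (simp add: Z2_pow_def)

lemma carrier_Z2_pow: "carrier (Z2_pow n) = {..<n} \<rightarrow>\<^sub>E {0..<2}"
  by (simp add: Z2_pow_def carrier_integer_mod_group)

lemma Z2_pow_square:
  assumes "x \<in> carrier (Z2_pow n)"
  shows "x \<otimes>\<^bsub>Z2_pow n\<^esub> x = \<one>\<^bsub>Z2_pow n\<^esub>"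
proof -
  have "(z + z) mod 2 = 0" for z :: int
    by presburger
  then show ?thesis
    by (simp add: Z2_pow_def)
qed

lemma comm_group_Z2_pow: "comm_group (Z2_pow n)"
proof (rule group.group_comm_groupI)
  show "x \<otimes>\<^bsub>Z2_pow n\<^esub> y = y \<otimes>\<^bsub>Z2_pow n\<^esub> x" for x y
    unfolding Z2_pow_def by (simp add: add.commute)
qed simp

lemma finite_Z2_pow [simp]: "finite (carrier (Z2_pow n))"
  by (simp add: carrier_Z2_pow finite_PiE)

lemma order_Z2_pow: "order (Z2_pow n) = 2 ^ n"
  by (simp add: order_def carrier_Z2_pow card_PiE)

text \<open>Splits off the coordinate with index \<open>n\<close>. Restriction and update are
  mutually inverse because elements of the product are extensional functions.\<close>

lemma Z2_pow_Suc_iso: "Z2_pow (Suc n) \<cong> integer_mod_group 2 \<times>\<times> Z2_pow n"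
proof (rule is_isoI, rule isoI)
  let ?f = "\<lambda>x. (x n, restrict x {..<n})"
  show "?f \<in> hom (Z2_pow (Suc n)) (integer_mod_group 2 \<times>\<times> Z2_pow n)"
    by (rule homI) (auto simp: Z2_pow_def carrier_integer_mod_group PiE_iff fun_eq_iff)
  show "bij_betw ?f (carrier (Z2_pow (Suc n))) (carrier (integer_mod_group 2 \<times>\<times> Z2_pow n))"
  proof (rule bij_betw_byWitness[where f' = "\<lambda>(a, x). x(n := a)"])
    have "(restrict x {..<n})(n := x n) = x" if "x \<in> {..<Suc n} \<rightarrow>\<^sub>E {0..<2::int}" for x
      using that by (auto simp: fun_eq_iff PiE_iff extensional_def)
    then show "\<forall>x\<in>carrier (Z2_pow (Suc n)). (case ?f x of (a, x) \<Rightarrow> x(n := a)) = x"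
      by (simp add: carrier_Z2_pow)
    have "restrict (x(n := a)) {..<n} = x" if "x \<in> {..<n} \<rightarrow>\<^sub>E {0..<2::int}" for a x
      using that by (auto simp: fun_eq_iff PiE_iff extensional_def)
    then show "\<forall>p\<in>carrier (integer_mod_group 2 \<times>\<times> Z2_pow n).
        ?f (case p of (a, x) \<Rightarrow> x(n := a)) = p"
      by (auto simp: carrier_Z2_pow)
    show "?f ` carrier (Z2_pow (Suc n)) \<subseteq> carrier (integer_mod_group 2 \<times>\<times> Z2_pow n)"
      by (simp add: image_subset_iff carrier_Z2_pow carrier_integer_mod_group PiE_iff)
    show "(\<lambda>(a, x). x(n := a)) ` carrier (integer_mod_group 2 \<times>\<times> Z2_pow n)
        \<subseteq> carrier (Z2_pow (Suc n))"
    proof safe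
      fix a :: int and x
      assume "(a, x) \<in> carrier (integer_mod_group 2 \<times>\<times> Z2_pow n)"
      then show "x(n := a) \<in> carrier (Z2_pow (Suc n))"
        by (auto simp: carrier_Z2_pow carrier_integer_mod_group PiE_iff extensional_def less_Suc_eq)
    qed
  qed
qed

text \<open>The Gaussian binomial coefficient \<open>[n choose k]\<close> at \<open>q = 2\<close>.\<close>

definition gauss :: "nat \<Rightarrow> nat \<Rightarrow> nat" where
  "gauss n k = card {K. subgroup K (Z2_pow n) \<and> card K = 2 ^ k}"

lemma card_subgroup_Z2_pow:
  assumes "subgroup K (Z2_pow n)"
  shows "\<exists>k\<le>n. card K = 2 ^ k"
proof -
  have "card K dvd 2 ^ n"
    using group.lagrange[OF group_Z2_pow assms] by (metis dvd_triv_right order_Z2_pow)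
  then show ?thesis
    using divides_primepow_nat[of 2 "card K" n] two_is_prime_nat by blast
qed

lemma gauss_eq_0: "n < k \<Longrightarrow> gauss n k = 0"
proof -
  assume "n < k"
  then have "card K \<noteq> 2 ^ k" if "subgroup K (Z2_pow n)" for K
    using card_subgroup_Z2_pow[OF that] by auto
  then have "{K. subgroup K (Z2_pow n) \<and> card K = 2 ^ k} = {}"
    by blast
  then show ?thesis
    unfolding gauss_def by (simp only: card.empty)
qed

lemma gauss_0_right: "gauss n 0 = 1"
proof -
  interpret group "Z2_pow n" by simp
  have "{K. subgroup K (Z2_pow n) \<and> card K = 1} = {{\<one>\<^bsub>Z2_pow n\<^esub>}}"
    using triv_subgroup by (auto simp: card_1_singleton_iff dest: subgroup.one_closed)
  then show ?thesis
    by (simp add: gauss_def)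
qed

text \<open>The Pascal rule, with coefficient 2^(n-k) counting the cosets of a subgroup of order
  2^k. Multiplying by 2^k avoids a truncated exponent.\<close>

lemma gauss_Suc_Suc: "2 ^ k * gauss (Suc n) (Suc k) = 2 ^ k * gauss n (Suc k) + 2 ^ n * gauss n k"
proof -
  interpret V: comm_group "Z2_pow n" by (rule comm_group_Z2_pow)
  have "card (rcosets\<^bsub>Z2_pow n\<^esub> M) * 2 ^ k = 2 ^ n" if "subgroup M (Z2_pow n)" "card M = 2 ^ k" for M
    using V.lagrange[OF that(1)] by (simp add: that order_Z2_pow)
  then have "2 ^ k * (\<Sum>M | subgroup M (Z2_pow n) \<and> card M = 2 ^ k. card (rcosets\<^bsub>Z2_pow n\<^esub> M)) =
      2 ^ n * gauss n k"
    by (simp add: sum_distrib_left gauss_def mult.commute)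
  moreover have "gauss (Suc n) (Suc k) =
      gauss n (Suc k) + (\<Sum>M | subgroup M (Z2_pow n) \<and> card M = 2 ^ k. card (rcosets\<^bsub>Z2_pow n\<^esub> M))"
    unfolding gauss_def
    using card_subgroups_Z2_DirProd[OF comm_group_Z2_pow finite_Z2_pow Z2_pow_square, of n "2 ^ Suc k"]
      iso_card_subgroups_of_card[OF Z2_pow_Suc_iso, of n "2 ^ Suc k"]
    by (simp add: DirProd_group)
  ultimately show ?thesis
    by (simp add: algebra_simps)
qed

lemma a2_eq_sum_gauss: "a2 n = (\<Sum>k\<le>n. gauss n k)"
proof -
  have "subgroups_of (Z2_pow n) = (\<Union>k\<le>n. {K. subgroup K (Z2_pow n) \<and> card K = 2 ^ k})"
    unfolding subgroups_of_def using card_subgroup_Z2_pow by blast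
  also have "card \<dots> = (\<Sum>k\<le>n. gauss n k)"
    unfolding gauss_def
    by (rule card_UN_disjoint) (auto intro: finite_subset[OF _ finite_subgroups[OF finite_Z2_pow]])
  finally show ?thesis
    by (simp add: a2_def)
qed

text \<open>The analogue at q = 2 of (n+1-k) C(n+1,k) = (n+1) C(n,k), again multiplied by 2^k. The
  induction uses the Pascal rule at two consecutive levels, with \<open>k\<close> arbitrary.\<close>

lemma gauss_Suc_left:
  "(2 ^ Suc n - 2 ^ k) * int (gauss (Suc n) k) = 2 ^ k * (2 ^ Suc n - 1) * int (gauss n k)"
proof (induction n arbitrary: k)
  case 0
  show ?case
  proof (cases "k \<ge> 2")
    case True
    then show ?thesis by (simp add: gauss_eq_0)
  next
    case False
    then have "k = 0 \<or> k = 1" by auto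
    then show ?thesis by (auto simp: gauss_0_right gauss_eq_0)
  qed
next
  case (Suc n)
  show ?case
  proof (cases k)
    case 0
    then show ?thesis by (simp add: gauss_0_right)
  next
    case (Suc j)
    define x y z w where "x = int (gauss (Suc n) (Suc j))" and "y = int (gauss (Suc n) j)"
      and "z = int (gauss n (Suc j))" and "w = int (gauss n j)"
    have r: "2 ^ j * int (gauss (Suc (Suc n)) (Suc j)) = 2 ^ j * x + 2 ^ Suc n * y"
      "2 ^ j * x = 2 ^ j * z + 2 ^ n * w"
      using gauss_Suc_Suc[of j "Suc n", THEN arg_cong[where f = int]]
        gauss_Suc_Suc[of j n, THEN arg_cong[where f = int]]
      by (simp_all add: x_def y_def z_def w_def)
    have IH: "(2 ^ Suc n - 2 ^ Suc j) * x = 2 ^ Suc j * (2 ^ Suc n - 1) * z"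
      "(2 ^ Suc n - 2 ^ j) * y = 2 ^ j * (2 ^ Suc n - 1) * w"
      unfolding x_def y_def z_def w_def by (rule Suc.IH)+
    define p m X where "p = (2::int) ^ j" and "m = (2::int) ^ n"
      and "X = int (gauss (Suc (Suc n)) (Suc j))"
    have pX: "p * X = p * x + 2 * m * y" and px: "p * x = p * z + m * w"
      and IHx: "(2 * m - 2 * p) * x = 2 * p * (2 * m - 1) * z" and IHy: "(2 * m - p) * y = p * (2 * m - 1) * w"
      using r IH by (simp_all add: p_def m_def X_def)
    \<comment> \<open>The Pascal rule gives only \<open>p * X\<close>, so the claim is first shown
      with a factor \<open>p\<close>. The unknowns \<open>y\<close>, \<open>w\<close>,
      \<open>z\<close> are eliminated in turn by \<open>IHy\<close>, \<open>px\<close> and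
      \<open>IHx\<close>, leaving only \<open>x\<close>.\<close>
    have "p * ((4 * m - 2 * p) * X) = (4 * m - 2 * p) * (p * X)"
      by simp
    also have "\<dots> = (4 * m - 2 * p) * (p * x) + 4 * m * ((2 * m - p) * y)"
      unfolding pX by (simp add: algebra_simps)
    also have "\<dots> = (4 * m - 2 * p) * (p * x) + 4 * p * (2 * m - 1) * (m * w)"
      unfolding IHy by (simp add: algebra_simps)
    also have "m * w = p * x - p * z"
      using px by simp
    also have "(4 * m - 2 * p) * (p * x) + 4 * p * (2 * m - 1) * (p * x - p * z) =
        (4 * m - 2 * p) * (p * x) + 4 * p * (2 * m - 1) * (p * x) - 2 * p * (2 * p * (2 * m - 1) * z)"
      by (simp add: algebra_simps)
    also have "\<dots> = p * (2 * p * (4 * m - 1) * x)"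
      unfolding IHx[symmetric] by (simp add: algebra_simps)
    finally have "p * ((4 * m - 2 * p) * X) = p * (2 * p * (4 * m - 1) * x)" .
    then show ?thesis
      by (simp add: Suc p_def m_def X_def x_def)
  qed
qed

section \<open>Recurrence and closed form for the number of subgroups of
  \<open>Z2_pow n\<close>\<close>

lemma a2_Suc: "a2 (Suc n) = a2 n + (\<Sum>k\<le>n. 2 ^ (n - k) * gauss n k)"
proof -
  have "gauss (Suc n) (Suc k) = gauss n (Suc k) + 2 ^ (n - k) * gauss n k" if "k \<le> n" for k
  proof -
    have "(2::nat) ^ n = 2 ^ k * 2 ^ (n - k)"
      using that by (simp flip: power_add)
    then have "2 ^ k * gauss (Suc n) (Suc k) = 2 ^ k * (gauss n (Suc k) + 2 ^ (n - k) * gauss n k)"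
      unfolding gauss_Suc_Suc by (simp add: distrib_left)
    then show ?thesis by simp
  qed
  then have "a2 (Suc n) = gauss n 0 + (\<Sum>k\<le>n. gauss n (Suc k)) + (\<Sum>k\<le>n. 2 ^ (n - k) * gauss n k)"
    unfolding a2_eq_sum_gauss sum.atMost_Suc_shift by (simp add: sum.distrib gauss_0_right)
  \<comment> \<open>These are the coefficients for 0 to n+1, of which the last vanishes.\<close>
  also have "gauss n 0 + (\<Sum>k\<le>n. gauss n (Suc k)) = a2 n"
    unfolding a2_eq_sum_gauss sum.atMost_Suc_shift[symmetric] by (simp add: gauss_eq_0)
  finally show ?thesis .
qed

lemma a2_0: "a2 0 = 1"
  by (simp add: a2_eq_sum_gauss gauss_0_right)

lemma a2_1: "a2 (Suc 0) = 2"
  by (simp add: a2_Suc a2_0 gauss_0_right)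

text \<open>The Goldman-Rota recurrence. In \<open>a2_Suc\<close> at \<open>Suc n\<close>, split
  each weight as 1 + (2^(n+1-k) - 1): the first part sums to \<open>a2 (Suc n)\<close>, and
  \<open>gauss_Suc_left\<close> turns the second into a multiple of \<open>gauss n k\<close> that
  does not depend on \<open>k\<close>.\<close>

lemma a2_Suc_Suc: "real (a2 (Suc (Suc n))) = 2 * real (a2 (Suc n)) + (2 ^ Suc n - 1) * real (a2 n)"
proof -
  have "int (2 ^ (Suc n - k) * gauss (Suc n) k) =
      int (gauss (Suc n) k) + (2 ^ Suc n - 1) * int (gauss n k)" if "k \<le> Suc n" for k
  proof -
    have "(2::int) ^ Suc n = 2 ^ k * 2 ^ (Suc n - k)"
      using that by (simp only: power_add[symmetric] le_add_diff_inverse)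
    then have "2 ^ k * ((2 ^ (Suc n - k) - 1) * int (gauss (Suc n) k)) =
        (2 ^ Suc n - 2 ^ k) * int (gauss (Suc n) k)"
      by (simp add: algebra_simps)
    also have "\<dots> = 2 ^ k * ((2 ^ Suc n - 1) * int (gauss n k))"
      unfolding gauss_Suc_left by simp
    finally have "(2 ^ (Suc n - k) - 1) * int (gauss (Suc n) k) = (2 ^ Suc n - 1) * int (gauss n k)"
      by simp
    then show ?thesis
      by (simp add: algebra_simps)
  qed
  then have "int (\<Sum>k\<le>Suc n. 2 ^ (Suc n - k) * gauss (Suc n) k) =
      (\<Sum>k\<le>Suc n. int (gauss (Suc n) k) + (2 ^ Suc n - 1) * int (gauss n k))"
    unfolding of_nat_sum by (intro sum.cong) auto
  also have "\<dots> = int (a2 (Suc n)) + (2 ^ Suc n - 1) * (\<Sum>k\<le>Suc n. int (gauss n k))"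
    by (simp only: sum.distrib sum_distrib_left[symmetric] a2_eq_sum_gauss of_nat_sum)
  also have "(\<Sum>k\<le>Suc n. int (gauss n k)) = int (a2 n)"
    by (simp add: a2_eq_sum_gauss gauss_eq_0)
  finally have "int (a2 (Suc (Suc n))) = 2 * int (a2 (Suc n)) + (2 ^ Suc n - 1) * int (a2 n)"
    by (simp only: a2_Suc[of "Suc n"] of_nat_add)
  then have "real_of_int (int (a2 (Suc (Suc n)))) =
      real_of_int (2 * int (a2 (Suc n)) + (2 ^ Suc n - 1) * int (a2 n))"
    by (rule arg_cong)
  then show ?thesis by simp
qed

text \<open>By the recurrence, 2^(m+1) \<open>a2 m\<close> is the second difference of
  \<open>a2\<close> at \<open>m\<close>, so the sum telescopes to a first difference minus its
  initial value 1.\<close>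

lemma sum_pow_a2: "2 * (\<Sum>\<alpha><m. 2 ^ \<alpha> * real (a2 \<alpha>)) = real (a2 (Suc m)) - real (a2 m) - 1"
proof (induction m)
  case 0
  show ?case by (simp add: a2_0 a2_1)
next
  case (Suc m)
  have "2 * (\<Sum>\<alpha><Suc m. 2 ^ \<alpha> * real (a2 \<alpha>)) =
      2 * (\<Sum>\<alpha><m. 2 ^ \<alpha> * real (a2 \<alpha>)) + 2 ^ Suc m * real (a2 m)"
    by simp
  also have "\<dots> = real (a2 (Suc (Suc m))) - real (a2 (Suc m)) - 1"
    unfolding Suc.IH a2_Suc_Suc by (simp add: left_diff_distrib)
  finally show ?case .
qed

text \<open>Handles the part of the summand in the closed form that does not involve
  \<open>n\<close>. The value is expressed by two consecutive terms of \<open>a2\<close>, so the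
  recurrence reduces the induction step to a polynomial identity.\<close>

lemma sum_diff_pow_a2:
  "8 * (\<Sum>\<alpha><m. (2 ^ (2 * \<alpha> + 1) - 2 ^ \<alpha>) * real (a2 \<alpha>)) =
    (2 ^ (m + 2) - 3) * real (a2 (Suc m)) - (3 * 2 ^ Suc m - 3) * real (a2 m) + 1"
proof (induction m)
  case 0
  show ?case by (simp add: a2_0 a2_1)
next
  case (Suc m)
  have "(2::real) ^ (2 * m + 1) = 2 * 2 ^ m * 2 ^ m"
    by (simp add: power_even_eq power2_eq_square)
  note pow_eq = this
  define p x y where "p = (2::real) ^ m" and "x = real (a2 m)" and "y = real (a2 (Suc m))"
  have eqs: "(2::real) ^ (m + 2) = 4 * p" "(2::real) ^ (Suc m + 2) = 8 * p" "(2::real) ^ m = p"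
    "(2::real) ^ Suc m = 2 * p" "(2::real) ^ Suc (Suc m) = 4 * p"
    "real (a2 (Suc (Suc m))) = 2 * y + (2 * p - 1) * x" "real (a2 m) = x" "real (a2 (Suc m)) = y"
    by (simp_all add: p_def x_def y_def a2_Suc_Suc)
  show ?case
    unfolding sum.lessThan_Suc distrib_left Suc.IH pow_eq eqs by (simp add: algebra_simps)
qed

text \<open>The left side is the count of \<open>b2_eq\<close>. On the right, the factor 2^n is
  pulled out of 2^(n+\<alpha>) so that the two preceding sums apply; both sides then reduce to
  \<open>a2 (n - 1)\<close> and \<open>a2 n\<close>.\<close>

lemma a2_closed_form:
  "real (a2 (n + 2)) + real (a2 (n + 1)) - real (a2 n) =
    2 ^ (n + 2) + 1
    + 8 * (\<Sum>\<alpha> | \<alpha> + 2 \<le> n. (2 ^ (n + \<alpha>) - 2 ^ (2 * \<alpha> + 1) + 2 ^ \<alpha>) * real (a2 \<alpha>))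
    + (if n = 0 then 0 else 2 ^ (n + 2) * real (a2 (n - 1))) + real (a2 n)"
proof (cases n)
  case 0
  \<comment> \<open>For n = 0 both sides equal 6, the number of subgroups of
    \<open>Q8\<close>.\<close>
  have "real (a2 (Suc (Suc 0))) = 5"
    using a2_Suc_Suc[of 0] by (simp add: a2_0 a2_1)
  then show ?thesis
    by (simp add: 0 a2_0 a2_1)
next
  case (Suc m)
  have "{\<alpha>. \<alpha> + 2 \<le> n} = {..<m}"
    using Suc by auto
  moreover have "(2 ^ (n + \<alpha>) - 2 ^ (2 * \<alpha> + 1) + 2 ^ \<alpha>) * real (a2 \<alpha>) =
      2 ^ n * (2 ^ \<alpha> * real (a2 \<alpha>)) - (2 ^ (2 * \<alpha> + 1) - 2 ^ \<alpha>) * real (a2 \<alpha>)" for \<alpha>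
    by (simp add: power_add algebra_simps)
  ultimately have "8 * (\<Sum>\<alpha> | \<alpha> + 2 \<le> n. (2 ^ (n + \<alpha>) - 2 ^ (2 * \<alpha> + 1) + 2 ^ \<alpha>) * real (a2 \<alpha>)) =
      4 * 2 ^ n * (2 * (\<Sum>\<alpha><m. 2 ^ \<alpha> * real (a2 \<alpha>)))
      - 8 * (\<Sum>\<alpha><m. (2 ^ (2 * \<alpha> + 1) - 2 ^ \<alpha>) * real (a2 \<alpha>))"
    by (simp add: sum_subtractf sum_distrib_left)
  note sum_eq = this
  define p x y where "p = (2::real) ^ m" and "x = real (a2 m)" and "y = real (a2 (Suc m))"
  have n: "real (a2 (n + 2)) = 2 * (2 * y + (2 * p - 1) * x) + (4 * p - 1) * y"
    "real (a2 (n + 1)) = 2 * y + (2 * p - 1) * x" "real (a2 n) = y"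
    "(2::real) ^ (n + 2) = 8 * p" "(2::real) ^ n = 2 * p"
    "(if n = 0 then 0 else 8 * p * real (a2 (n - 1))) = 8 * p * x"
    by (simp_all add: Suc a2_Suc_Suc p_def x_def y_def)
  have m: "2 * (\<Sum>\<alpha><m. 2 ^ \<alpha> * real (a2 \<alpha>)) = y - x - 1"
    "8 * (\<Sum>\<alpha><m. (2 ^ (2 * \<alpha> + 1) - 2 ^ \<alpha>) * real (a2 \<alpha>)) =
      (4 * p - 3) * y - (6 * p - 3) * x + 1"
    using sum_pow_a2[of m] sum_diff_pow_a2[of m] by (simp_all add: p_def x_def y_def)
  show ?thesis
    unfolding sum_eq m n by (simp add: algebra_simps)
qed

section \<open>The quaternion group times an elementary abelian 2-group\<close>

lemma carrier_Q8: "carrier Q8 =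
    {(1,0,0,0), (-1,0,0,0), (0,1,0,0), (0,-1,0,0), (0,0,1,0), (0,0,-1,0), (0,0,0,1), (0,0,0,-1)}"
  by (simp add: Q8_def)

lemma one_Q8: "\<one>\<^bsub>Q8\<^esub> = (1,0,0,0)"
  by (simp add: Q8_def)

lemma mult_Q8: "(a,b,c,d) \<otimes>\<^bsub>Q8\<^esub> (a',b',c',d') =
    (a*a' - b*b' - c*c' - d*d', a*b' + b*a' + c*d' - d*c',
     a*c' - b*d' + c*a' + d*b', a*d' + b*c' - c*b' + d*a')"
  by (simp add: Q8_def)

text \<open>Associativity is a polynomial identity for all integer quadruples, which avoids 8^3
  cases; closure and inverses are checked unit by unit.\<close>

lemma group_Q8 [simp]: "group Q8"
proof (rule groupI)
  show "x \<otimes>\<^bsub>Q8\<^esub> y \<in> carrier Q8" if "x \<in> carrier Q8" "y \<in> carrier Q8" for x y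
    using that unfolding carrier_Q8 by (elim insertE emptyE; simp add: mult_Q8)
  show "x \<otimes>\<^bsub>Q8\<^esub> y \<otimes>\<^bsub>Q8\<^esub> z = x \<otimes>\<^bsub>Q8\<^esub> (y \<otimes>\<^bsub>Q8\<^esub> z)" for x y z
    by (cases x; cases y; cases z) (simp add: mult_Q8 algebra_simps)
  show "\<exists>y\<in>carrier Q8. y \<otimes>\<^bsub>Q8\<^esub> x = \<one>\<^bsub>Q8\<^esub>" if "x \<in> carrier Q8" for x
    using that unfolding carrier_Q8 by (elim insertE emptyE; simp add: mult_Q8 one_Q8)
qed (auto simp: carrier_Q8 one_Q8 mult_Q8)

lemma order_Q8: "order Q8 = 8"
  by (simp add: order_def carrier_Q8)

lemma inv_Q8: "(a,b,c,d) \<in> carrier Q8 \<Longrightarrow> inv\<^bsub>Q8\<^esub> (a,b,c,d) = (a,-b,-c,-d)"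
  by (rule group.inv_equality[OF group_Q8]) (auto simp: carrier_Q8 one_Q8 mult_Q8)

section \<open>Cyclic subgroups generated by elements of order dividing 4\<close>

text \<open>Exponents can be reduced modulo 4, and the third power is the inverse.\<close>

lemma (in group) generate_pow4:
  assumes x: "x \<in> carrier G" and x4: "x \<otimes> x \<otimes> (x \<otimes> x) = \<one>"
  shows "generate G {x} \<subseteq> {\<one>, x, x \<otimes> x, inv x}"
proof
  fix y assume "y \<in> generate G {x}"
  then obtain k :: int where k: "y = x [^] k"
    using generate_pow[OF x] by auto
  have x2: "x [^] (2::int) = x \<otimes> x"
    using int_pow_mult[OF x, of 1 1] x by simp
  have "x [^] (4::int) = \<one>"
    using int_pow_mult[OF x, of 2 2] x4 x2 by simp
  then have "x [^] (4 * (k div 4)) = \<one>"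
    using int_pow_pow[OF x, of 4 "k div 4"] by (metis int_pow_one)
  then have "y = x [^] (k mod 4)"
    using int_pow_mult[OF x, of "4 * (k div 4)" "k mod 4"] x k by simp
  moreover have "k mod 4 \<in> {0, 1, 2, 3}"
    by auto
  moreover have "x [^] (3::int) = inv x"
  proof -
    have "x [^] (3::int) = x [^] (4::int) \<otimes> x [^] (-1::int)"
      using int_pow_mult[OF x, of 4 "-1"] by simp
    then show ?thesis
      using \<open>x [^] (4::int) = \<one>\<close> x by (simp add: int_pow_neg)
  qed
  ultimately show "y \<in> {\<one>, x, x \<otimes> x, inv x}"
    using x2 x by force
qed

lemma (in group) generate_inv: "x \<in> carrier G \<Longrightarrow> generate G {inv x} = generate G {x}"
proof -
  assume x: "x \<in> carrier G"
  have sub: "generate G {inv y} \<subseteq> generate G {y}" if "y \<in> carrier G" for y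
    using that by (intro generate_subgroup_incl generate_is_subgroup) (auto intro: generate.inv)
  show ?thesis
    using sub[of x] sub[of "inv x"] x by auto
qed

text \<open>Each of \<open>x\<close> and \<open>y\<close> is among the four powers of the other; it
  remains to see that \<open>y = \<one>\<close> and \<open>y = x \<otimes> x\<close> occur only if
  \<open>y = x\<close>.\<close>

lemma (in group) generate_eq_pow4:
  assumes x: "x \<in> carrier G" "x \<otimes> x \<otimes> (x \<otimes> x) = \<one>"
    and y: "y \<in> carrier G" "y \<otimes> y \<otimes> (y \<otimes> y) = \<one>"
    and eq: "generate G {x} = generate G {y}"
  shows "y = x \<or> y = inv x"
proof -
  have yx: "y \<in> {\<one>, x, x \<otimes> x, inv x}"
    using generate_pow4[OF x] eq generate.incl[of y "{y}" G] by auto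
  have xy: "x \<in> {\<one>, y, y \<otimes> y, inv y}"
    using generate_pow4[OF y] eq generate.incl[of x "{x}" G] by auto
  have "y = x" if "y = \<one>"
    using xy that by auto
  \<comment> \<open>Here \<open>y\<close> is an involution or trivial, so its only powers are
    \<open>\<one>\<close> and \<open>y\<close>; if \<open>x = \<one>\<close>, then
    \<open>y = \<one>\<close> too.\<close>
  moreover have "y = x" if "y = x \<otimes> x"
  proof -
    have "y \<otimes> y = \<one>"
      using x(2) that by simp
    moreover from this have "inv y = y"
      using y by (simp add: inv_equality)
    ultimately have "x = \<one> \<or> x = y"
      using xy by auto
    then show ?thesis
      using that by auto
  qed
  ultimately show ?thesis
    using yx by blast
qed

section \<open>Counting the subgroups of \<open>Q8 \<times>\<times> Z2_pow n\<close>\<close>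

lemma card_subgroups_containing_Q8:
  "card {K. subgroup K (Q8 \<times>\<times> Z2_pow n) \<and> ((-1,0,0,0), \<one>\<^bsub>Z2_pow n\<^esub>) \<in> K} = a2 (Suc (Suc n))"
proof -
  let ?G = "Q8 \<times>\<times> Z2_pow n"
  let ?Z = "integer_mod_group 2"
  let ?H = "?Z \<times>\<times> (?Z \<times>\<times> Z2_pow n)"
  \<comment> \<open>On \<open>Q8\<close> this is the quotient map by {1, -1}: reduction modulo 2
    forgets signs, and 1, i, j, k go to (0,0), (1,0), (0,1), (1,1).\<close>
  let ?h = "\<lambda>((a,b,c,d), f). ((b + d) mod 2, (c + d) mod 2, f)"
  have car: "carrier ?Z = {0, 1}"
    by (auto simp: carrier_integer_mod_group)
  have G: "group ?G" and H: "group ?H"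
    by (simp_all add: DirProd_group)
  have hom: "?h \<in> hom ?G ?H"
  proof (rule homI)
    show "?h x \<in> carrier ?H" if "x \<in> carrier ?G" for x
      using that by (auto simp: carrier_Q8 car)
    show "?h (x \<otimes>\<^bsub>?G\<^esub> y) = ?h x \<otimes>\<^bsub>?H\<^esub> ?h y" if "x \<in> carrier ?G" "y \<in> carrier ?G" for x y
    proof -
      obtain q f q' f' where [simp]: "x = (q, f)" "y = (q', f')"
        by fastforce
      have "q \<in> carrier Q8" "q' \<in> carrier Q8"
        using that by auto
      then show ?thesis
        unfolding carrier_Q8 by (elim insertE emptyE; simp add: mult_Q8)
    qed
  qed
  interpret group_hom ?G ?H ?h
    using G H hom by (simp add: group_hom_def group_hom_axioms_def)
  have "?h ` carrier ?G = carrier ?H"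
  proof (intro equalityI subsetI)
    fix p assume "p \<in> carrier ?H"
    then obtain a b f where p: "p = (a, b, f)" "a \<in> {0, 1}" "b \<in> {0, 1}" "f \<in> carrier (Z2_pow n)"
      by (auto simp: car)
    \<comment> \<open>The preimage of \<open>(a, b)\<close> among 1, i, j, k.\<close>
    define q :: "int \<times> int \<times> int \<times> int" where
      "q = (if a = 0 then (if b = 0 then (1,0,0,0) else (0,0,1,0))
            else (if b = 0 then (0,1,0,0) else (0,0,0,1)))"
    have "(q, f) \<in> carrier ?G" "p = ?h (q, f)"
      using p by (auto simp: q_def carrier_Q8)
    then show "p \<in> ?h ` carrier ?G"
      by (rule rev_image_eqI)
  next
    show "p \<in> carrier ?H" if "p \<in> ?h ` carrier ?G" for p
      using that hom_carrier[OF hom] by blast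
  qed
  moreover have "kernel ?G ?H ?h = {\<one>\<^bsub>?G\<^esub>, ((-1,0,0,0), \<one>\<^bsub>Z2_pow n\<^esub>)}"
    using group.is_monoid[OF group_Z2_pow[of n]]
    by (auto simp: kernel_def carrier_Q8 one_Q8)
  ultimately have "card {K. subgroup K ?G \<and> {\<one>\<^bsub>?G\<^esub>, ((-1,0,0,0), \<one>\<^bsub>Z2_pow n\<^esub>)} \<subseteq> K} =
      card (subgroups_of ?H)"
    using card_subgroups_containing_kernel by simp
  moreover have "{K. subgroup K ?G \<and> {\<one>\<^bsub>?G\<^esub>, ((-1,0,0,0), \<one>\<^bsub>Z2_pow n\<^esub>)} \<subseteq> K} =
      {K. subgroup K ?G \<and> ((-1,0,0,0), \<one>\<^bsub>Z2_pow n\<^esub>) \<in> K}"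
    by (auto dest: subgroup.one_closed)
  moreover have "Z2_pow (Suc (Suc n)) \<cong> ?H"
    using Z2_pow_Suc_iso[of "Suc n"]
      group.DirProd_iso_trans[OF group_integer_mod_group iso_refl Z2_pow_Suc_iso[of n]]
    by (rule iso_trans)
  ultimately show ?thesis
    using iso_card_subgroups_of[of "Z2_pow (Suc (Suc n))" ?H] H by (simp add: a2_def)
qed

text \<open>\<open>(1, \<one>)\<close> generates the kernel of the projection to
  \<open>Z2_pow n\<close>. Under the embedding of the next lemma it becomes the square of i.\<close>

lemma card_subgroups_Z2_DirProd_containing:
  "card {K. subgroup K (integer_mod_group 2 \<times>\<times> Z2_pow n) \<and> (1, \<one>\<^bsub>Z2_pow n\<^esub>) \<in> K} = a2 n"
proof -
  let ?P = "integer_mod_group 2 \<times>\<times> Z2_pow n"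
  interpret group_hom ?P "Z2_pow n" snd
    by (rule group_hom_snd) simp_all
  have "snd ` carrier ?P = carrier (Z2_pow n)"
    by (force simp: carrier_integer_mod_group)
  moreover have "kernel ?P (Z2_pow n) snd = {\<one>\<^bsub>?P\<^esub>, (1, \<one>\<^bsub>Z2_pow n\<^esub>)}"
    by (auto simp: kernel_def carrier_integer_mod_group)
  ultimately have "card {K. subgroup K ?P \<and> {\<one>\<^bsub>?P\<^esub>, (1, \<one>\<^bsub>Z2_pow n\<^esub>)} \<subseteq> K} = a2 n"
    using card_subgroups_containing_kernel by (simp add: a2_def)
  moreover have "{K. subgroup K ?P \<and> {\<one>\<^bsub>?P\<^esub>, (1, \<one>\<^bsub>Z2_pow n\<^esub>)} \<subseteq> K} =
      {K. subgroup K ?P \<and> (1, \<one>\<^bsub>Z2_pow n\<^esub>) \<in> K}"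
    by (auto dest: subgroup.one_closed)
  ultimately show ?thesis by simp
qed

text \<open>Elements over i, j, k and their negatives square to \<open>?z\<close>, since the second
  coordinate squares to \<open>\<one>\<close>. A subgroup avoiding \<open>?z\<close> therefore lies
  over {1, -1}, that is, in the centre.\<close>

lemma card_subgroups_not_containing_Q8:
  "card {K. subgroup K (Q8 \<times>\<times> Z2_pow n) \<and> ((-1,0,0,0), \<one>\<^bsub>Z2_pow n\<^esub>) \<notin> K} =
    card {K. subgroup K (integer_mod_group 2 \<times>\<times> Z2_pow n) \<and> (1, \<one>\<^bsub>Z2_pow n\<^esub>) \<notin> K}"
proof -
  let ?G = "Q8 \<times>\<times> Z2_pow n"
  let ?P = "integer_mod_group 2 \<times>\<times> Z2_pow n"
  let ?z = "((-1,0,0,0), \<one>\<^bsub>Z2_pow n\<^esub>) :: (int \<times> int \<times> int \<times> int) \<times> (nat \<Rightarrow> int)"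
  \<comment> \<open>\<open>1 - 2 * a\<close> turns the additive 0, 1 into the signs 1, -1, so
    \<open>(1, \<one>)\<close> goes to \<open>?z\<close>.\<close>
  let ?h = "\<lambda>(a, f). ((1 - 2 * a, 0, 0, 0), f) :: (int \<times> int \<times> int \<times> int) \<times> (nat \<Rightarrow> int)"
  interpret E: group "Z2_pow n" by simp
  have car: "carrier (integer_mod_group 2) = {0, 1}"
    by (auto simp: carrier_integer_mod_group)
  have hom: "?h \<in> hom ?P ?G"
    by (rule homI) (auto simp: car carrier_Q8 mult_Q8)
  interpret group_hom ?P ?G ?h
    using hom by (simp add: group_hom_def group_hom_axioms_def DirProd_group)
  have ker: "kernel ?P ?G ?h = {\<one>\<^bsub>?P\<^esub>}"
    by (auto simp: kernel_def car one_Q8)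
  have "L \<subseteq> ?h ` carrier ?P" if L: "subgroup L ?G" "?z \<notin> L" for L
  proof
    fix p assume p: "p \<in> L"
    then obtain q f where qf: "p = (q, f)" "q \<in> carrier Q8" "f \<in> carrier (Z2_pow n)"
      using subgroup.mem_carrier[OF L(1) p] by auto
    have "p \<otimes>\<^bsub>?G\<^esub> p \<in> L"
      using L p by (auto intro: subgroup.m_closed)
    then have "(q \<otimes>\<^bsub>Q8\<^esub> q, \<one>\<^bsub>Z2_pow n\<^esub>) \<in> L"
      using qf Z2_pow_square by simp
    then have "q \<otimes>\<^bsub>Q8\<^esub> q \<noteq> (-1,0,0,0)"
      using L(2) by auto
    then have "q = (1,0,0,0) \<or> q = (-1,0,0,0)"
      using qf(2) by (auto simp: carrier_Q8 mult_Q8)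
    then have "?h (0, f) = p \<or> ?h (1, f) = p"
      using qf(1) by auto
    then show "p \<in> ?h ` carrier ?P"
      using qf(3) by (force simp: car)
  qed
  then have eq_G: "{L. subgroup L ?G \<and> ?z \<notin> L} =
      {L \<in> {L. subgroup L ?G \<and> L \<subseteq> ?h ` carrier ?P}. ?z \<notin> L}"
    by blast
  have eq_P: "{K. subgroup K ?P \<and> (1, \<one>\<^bsub>Z2_pow n\<^esub>) \<notin> K} =
      {K \<in> {K. subgroup K ?P \<and> kernel ?P ?G ?h \<subseteq> K}. (1, \<one>\<^bsub>Z2_pow n\<^esub>) \<notin> K}"
    unfolding ker by (auto dest: subgroup.one_closed)
  have "?z \<in> ?h ` K \<longleftrightarrow> (1, \<one>\<^bsub>Z2_pow n\<^esub>) \<in> K" for K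
    by force
  then have bij: "bij_betw (\<lambda>K. ?h ` K)
      {K \<in> {K. subgroup K ?P \<and> kernel ?P ?G ?h \<subseteq> K}. (1, \<one>\<^bsub>Z2_pow n\<^esub>) \<notin> K}
      {L \<in> {L. subgroup L ?G \<and> L \<subseteq> ?h ` carrier ?P}. ?z \<notin> L}"
    by (intro bij_betw_Collect subgroup_correspondence) simp
  show ?thesis
    unfolding eq_G eq_P using bij_betw_same_card[OF bij] by (rule sym)
qed

lemma card_Collect_split:
  assumes "finite {x. P x}"
  shows "card {x. P x} = card {x. P x \<and> Q x} + card {x. P x \<and> \<not> Q x}"
proof -
  have "card {x. P x} = card ({x. P x \<and> Q x} \<union> {x. P x \<and> \<not> Q x})"
    by (rule arg_cong[where f = card]) blast
  also have "\<dots> = card {x. P x \<and> Q x} + card {x. P x \<and> \<not> Q x}"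
    by (rule card_Un_disjoint) (auto intro: finite_subset[OF _ assms])
  finally show ?thesis .
qed

lemma finite_Q8_DirProd: "finite (carrier (Q8 \<times>\<times> Z2_pow n))"
  by (simp add: carrier_Q8)

text \<open>Subgroups with \<open>z\<close> are counted by the quotient; those without
  \<open>z\<close> are all subgroups of the centre minus the \<open>a2 n\<close> ones containing
  \<open>z\<close>. The additive form avoids truncated subtraction.\<close>

lemma b2_eq: "b2 n + a2 n = a2 (Suc (Suc n)) + a2 (Suc n)"
proof -
  let ?P = "integer_mod_group 2 \<times>\<times> Z2_pow n"
  have "b2 n = card {K. subgroup K (Q8 \<times>\<times> Z2_pow n)}"
    by (simp add: b2_def subgroups_of_def)
  also have "\<dots> = a2 (Suc (Suc n)) + card {K. subgroup K ?P \<and> (1, \<one>\<^bsub>Z2_pow n\<^esub>) \<notin> K}"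
    using card_Collect_split[OF finite_subgroups[OF finite_Q8_DirProd],
        of n "\<lambda>K. ((-1,0,0,0), \<one>\<^bsub>Z2_pow n\<^esub>) \<in> K"]
    by (simp only: card_subgroups_containing_Q8 card_subgroups_not_containing_Q8)
  finally have "b2 n = a2 (Suc (Suc n)) + card {K. subgroup K ?P \<and> (1, \<one>\<^bsub>Z2_pow n\<^esub>) \<notin> K}" .
  moreover have "a2 (Suc n) = card {K. subgroup K ?P}"
    using iso_card_subgroups_of[OF Z2_pow_Suc_iso, of n] by (simp add: a2_def DirProd_group subgroups_of_def)
  moreover have "finite (carrier ?P)"
    by (simp add: carrier_integer_mod_group)
  ultimately show ?thesis
    using card_Collect_split[OF finite_subgroups, of ?P "\<lambda>K. (1, \<one>\<^bsub>Z2_pow n\<^esub>) \<in> K"]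
    by (simp add: card_subgroups_Z2_DirProd_containing)
qed

section \<open>Counting the cyclic subgroups of \<open>Q8 \<times>\<times> Z2_pow n\<close>\<close>

lemma card_cyclic_subgroups_Q8: "card (cyclic_subgroups_of (Q8 \<times>\<times> Z2_pow n)) = 5 * 2 ^ n"
proof -
  let ?G = "Q8 \<times>\<times> Z2_pow n"
  interpret E: group "Z2_pow n" by simp
  interpret group ?G by (simp add: DirProd_group)
  \<comment> \<open>One unit from each pair of mutual inverses; 1 and -1 are their own inverses.
    Second coordinates are self-inverse, so all of them are kept.\<close>
  define R :: "(int \<times> int \<times> int \<times> int) set" where
    "R = {(1,0,0,0), (-1,0,0,0), (0,1,0,0), (0,0,1,0), (0,0,0,1)}"
  have R: "R \<subseteq> carrier Q8"
    by (auto simp: R_def carrier_Q8)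
  have inv_E: "inv\<^bsub>Z2_pow n\<^esub> f = f" if "f \<in> carrier (Z2_pow n)" for f
    using that Z2_pow_square by (simp add: E.inv_equality)
  have pow4: "x \<otimes>\<^bsub>?G\<^esub> x \<otimes>\<^bsub>?G\<^esub> (x \<otimes>\<^bsub>?G\<^esub> x) = \<one>\<^bsub>?G\<^esub>" if "x \<in> carrier ?G" for x
  proof -
    obtain q f where x: "x = (q, f)" "q \<in> carrier Q8" "f \<in> carrier (Z2_pow n)"
      using \<open>x \<in> carrier ?G\<close> by auto
    have "q \<otimes>\<^bsub>Q8\<^esub> q \<otimes>\<^bsub>Q8\<^esub> (q \<otimes>\<^bsub>Q8\<^esub> q) = \<one>\<^bsub>Q8\<^esub>"
      using x(2) by (auto simp: carrier_Q8 mult_Q8 one_Q8)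
    then show ?thesis
      using x Z2_pow_square[of f n] by simp
  qed
  have inv_G: "inv\<^bsub>?G\<^esub> (q, f) = (inv\<^bsub>Q8\<^esub> q, f)" if "q \<in> carrier Q8" "f \<in> carrier (Z2_pow n)" for q f
    using that by (simp add: inv_DirProd inv_E)
  have inv_R: "inv\<^bsub>Q8\<^esub> q = q" if "q \<in> R" "inv\<^bsub>Q8\<^esub> q \<in> R" for q
    using that R by (auto simp: R_def inv_Q8 carrier_Q8)
  have "inj_on (\<lambda>x. generate ?G {x}) (R \<times> carrier (Z2_pow n))"
  proof (rule inj_onI)
    fix x y assume x: "x \<in> R \<times> carrier (Z2_pow n)" and y: "y \<in> R \<times> carrier (Z2_pow n)"
      and "generate ?G {x} = generate ?G {y}"
    then have "y = x \<or> y = inv\<^bsub>?G\<^esub> x"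
      using R by (intro generate_eq_pow4 pow4) auto
    \<comment> \<open>The only elements of \<open>R\<close> whose inverses lie in \<open>R\<close>
      are 1 and -1, so inverse representatives coincide.\<close>
    moreover have "inv\<^bsub>?G\<^esub> x = x" if "inv\<^bsub>?G\<^esub> x \<in> R \<times> carrier (Z2_pow n)"
    proof -
      obtain q f where x_eq: "x = (q, f)" by (cases x)
      then show ?thesis
        using x that subsetD[OF R, of q] inv_G[of q f] inv_R[of q] by simp
    qed
    ultimately show "x = y"
      using y by metis
  qed
  moreover have "cyclic_subgroups_of ?G = (\<lambda>x. generate ?G {x}) ` (R \<times> carrier (Z2_pow n))"
  proof -
    have "\<exists>y\<in>R \<times> carrier (Z2_pow n). generate ?G {x} = generate ?G {y}" if x: "x \<in> carrier ?G" for x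
    proof -
      obtain q f where qf: "x = (q, f)" "q \<in> carrier Q8" "f \<in> carrier (Z2_pow n)"
        using x by auto
      have "q \<in> R \<or> inv\<^bsub>Q8\<^esub> q \<in> R"
        using qf(2) by (auto simp: R_def inv_Q8 carrier_Q8)
      moreover have "generate ?G {x} = generate ?G {(inv\<^bsub>Q8\<^esub> q, f)}"
        using generate_inv[OF x] inv_G[OF qf(2,3)] by (simp only: qf(1))
      ultimately show ?thesis
        using qf by auto
    qed
    moreover have "R \<times> carrier (Z2_pow n) \<subseteq> carrier ?G"
      using R by auto
    ultimately show ?thesis
      unfolding cyclic_subgroups_of_eq by blast
  qed
  ultimately have "card (cyclic_subgroups_of ?G) = card R * order (Z2_pow n)"
    by (simp add: card_image card_cartesian_product order_def)
  then show ?thesis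
    by (simp add: R_def order_Z2_pow)
qed

section \<open>Splitting off the factor of odd order\<close>

text \<open>\<open>\<times>\<times>\<close> associates to the right, whereas the coprime splitting
  needs the 2-group \<open>Q8 \<times>\<times> Z2_pow n\<close> as one factor.\<close>

lemma DirProd_assoc_iso: "G \<times>\<times> (H \<times>\<times> I) \<cong> (G \<times>\<times> H) \<times>\<times> I"
proof (rule is_isoI, rule isoI)
  let ?f = "\<lambda>(x, y, z). ((x, y), z)"
  show "?f \<in> hom (G \<times>\<times> (H \<times>\<times> I)) ((G \<times>\<times> H) \<times>\<times> I)"
    by (rule homI) auto
  show "bij_betw ?f (carrier (G \<times>\<times> (H \<times>\<times> I))) (carrier ((G \<times>\<times> H) \<times>\<times> I))"
    by (rule bij_betw_byWitness[where f' = "\<lambda>((x, y), z). (x, y, z)"]) auto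
qed

theorem theorem3p2p1:
  fixes H :: "('h, 'm) monoid_scheme" and A :: "('a, 'k) monoid_scheme" and n :: nat
  assumes "comm_group A" and "finite (carrier A)" and "odd (order A)"
    and "hamiltonian_group H"
    and "H \<cong> Q8 \<times>\<times> Z2_pow n \<times>\<times> A"
  shows "cdeg H = 5 * 2 ^ n / real (b2 n) * cdeg A \<and>
    real (b2 n) =
      2 ^ (n + 2) + 1
      + 8 * (\<Sum>\<alpha> | \<alpha> + 2 \<le> n.
               (2 ^ (n + \<alpha>) - 2 ^ (2 * \<alpha> + 1) + 2 ^ \<alpha>) * real (a2 \<alpha>))
      + (if n = 0 then 0 else 2 ^ (n + 2) * real (a2 (n - 1)))
      + real (a2 n)"
proof
  let ?G = "Q8 \<times>\<times> Z2_pow n"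
  have A: "group A" and H: "group H" and G: "group ?G"
    using assms by (simp_all add: comm_group_def hamiltonian_group_def DirProd_group)
  have iso: "H \<cong> ?G \<times>\<times> A"
    using assms(5) DirProd_assoc_iso by (rule iso_trans)
  have "order ?G = 2 ^ (n + 3)"
    using order_Q8 order_Z2_pow[of n] by (simp add: order_def card_cartesian_product power_add)
  then have cop: "coprime (order ?G) (order A)"
    using \<open>odd (order A)\<close> by (simp add: coprime_power_left_iff)
  have "card (cyclic_subgroups_of H) = 5 * 2 ^ n * card (cyclic_subgroups_of A)"
    using iso_card_cyclic_subgroups_of[OF iso H DirProd_group[OF G A]]
      card_cyclic_subgroups_of_DirProd_coprime[OF G A assms(2) cop] card_cyclic_subgroups_Q8[of n] by simp
  moreover have "card (subgroups_of H) = b2 n * card (subgroups_of A)"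
    using iso_card_subgroups_of[OF iso H DirProd_group[OF G A]]
      card_subgroups_of_DirProd_coprime[OF G A assms(2) cop] by (simp add: b2_def)
  ultimately show "cdeg H = 5 * 2 ^ n / real (b2 n) * cdeg A"
    by (simp add: cdeg_def)
  \<comment> \<open>Over the reals the additive \<open>b2_eq\<close> can be solved for
    \<open>b2 n\<close>, giving the left side of \<open>a2_closed_form\<close>.\<close>
  have "real (b2 n) = real (a2 (n + 2)) + real (a2 (n + 1)) - real (a2 n)"
    using b2_eq[of n, THEN arg_cong[where f = real]] by simp
  then show "real (b2 n) =
      2 ^ (n + 2) + 1
      + 8 * (\<Sum>\<alpha> | \<alpha> + 2 \<le> n.
               (2 ^ (n + \<alpha>) - 2 ^ (2 * \<alpha> + 1) + 2 ^ \<alpha>) * real (a2 \<alpha>))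
      + (if n = 0 then 0 else 2 ^ (n + 2) * real (a2 (n - 1)))
      + real (a2 n)"
    unfolding a2_closed_form .
qed

end
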